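(* Let $\beta\ge 0$, let $\boldsymbol{\theta}_0\in\Theta$, and let $\boldsymbol{x}$ be a point of the sample space. (i) For the Wald-type test functional for the simple null hypothesis $H_0:\boldsymbol{\theta}=\boldsymbol{\theta}_0$, $$W_\beta^0(G)=(\boldsymbol{T}_\beta(G)-\boldsymbol{\theta}_0)^T\boldsymbol{\Sigma}_\beta^{-1}(\boldsymbol{\theta}_0)(\boldsymbol{T}_\beta(G)-\boldsymbol{\theta}_0),$$ the second order influence function at $F_{\boldsymbol{\theta}_0}$ is $$\mathcal{IF}_2(\boldsymbol{x},W_\beta^0,F_{\boldsymbol{\theta}_0})=2\left(\boldsymbol{u}_{\boldsymbol{\theta}_0}(\boldsymbol{x})f_{\boldsymbol{\theta}_0}^\beta(\boldsymbol{x})-\boldsymbol{\xi}_\beta(\boldsymbol{\theta}_0)\right)^T\boldsymbol{J}_\beta^{-1}(\boldsymbol{\theta}_0)\boldsymbol{\Sigma}_\beta^{-1}(\boldsymbol{\theta}_0)\boldsymbol{J}_\beta^{-1}(\boldsymbol{\theta}_0)\left(\boldsymbol{u}_{\boldsymbol{\theta}_0}(\boldsymbol{x})f_{\boldsymbol{\theta}_0}^\beta(\boldsymbol{x})-\boldsymbol{\xi}_\beta(\boldsymbol{\theta}_0)\right).$$ (ii) Let in addition $\boldsymbol{\theta}_0\in\Theta_0=\{\boldsymbol{\theta}\in\Theta:\boldsymbol{m}(\boldsymbol{\theta})=\boldsymbol{0}_r\}$. For the Wald-type test functional for the composite null hypothesis $H_0:\boldsymbol{\theta}\in\Theta_0$,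 $$W_\beta(G)=\boldsymbol{m}^T(\boldsymbol{T}_\beta(G))\left(\boldsymbol{M}^T(\boldsymbol{T}_\beta(G))\boldsymbol{\Sigma}_\beta(\boldsymbol{T}_\beta(G))\boldsymbol{M}(\boldsymbol{T}_\beta(G))\right)^{-1}\boldsymbol{m}(\boldsymbol{T}_\beta(G)),$$ the second order influence function at $F_{\boldsymbol{\theta}_0}$ is $$\mathcal{IF}_2(\boldsymbol{x},W_\beta,F_{\boldsymbol{\theta}_0})=2\left(\boldsymbol{u}_{\boldsymbol{\theta}_0}(\boldsymbol{x})f_{\boldsymbol{\theta}_0}^\beta(\boldsymbol{x})-\boldsymbol{\xi}_\beta(\boldsymbol{\theta}_0)\right)^T\boldsymbol{J}_\beta^{-1}(\boldsymbol{\theta}_0)\boldsymbol{M}(\boldsymbol{\theta}_0)\boldsymbol{\Sigma}_\beta^{\ast-1}(\boldsymbol{\theta}_0)\boldsymbol{M}^T(\boldsymbol{\theta}_0)\boldsymbol{J}_\beta^{-1}(\boldsymbol{\theta}_0)\left(\boldsymbol{u}_{\boldsymbol{\theta}_0}(\boldsymbol{x})f_{\boldsymbol{\theta}_0}^\beta(\boldsymbol{x})-\boldsymbol{\xi}_\beta(\boldsymbol{\theta}_0)\right),$$ where $\boldsymbol{\Sigma}_\beta^\ast(\boldsymbol{\theta}_0)=\boldsymbol{M}^T(\boldsymbol{\theta}_0)\boldsymbol{\Sigma}_\beta(\boldsymbol{\theta}_0)\boldsymbol{M}(\boldsymbol{\theta}_0)$.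
   Context: $\{F_{\boldsymbol{\theta}}:\boldsymbol{\theta}\in\Theta\subset\mathbb{R}^p\}$ is a parametric family of distributions with densities $f_{\boldsymbol{\theta}}$ with respect to a common dominating measure, written $d\boldsymbol{x}$. Put $\boldsymbol{u}_{\boldsymbol{\theta}}(\boldsymbol{x})=\frac{\partial}{\partial\boldsymbol{\theta}}\log f_{\boldsymbol{\theta}}(\boldsymbol{x})$, $\boldsymbol{\xi}_\beta(\boldsymbol{\theta})=\int\boldsymbol{u}_{\boldsymbol{\theta}}f_{\boldsymbol{\theta}}^{1+\beta}d\boldsymbol{x}$, $\boldsymbol{J}_\beta(\boldsymbol{\theta})=\int\boldsymbol{u}_{\boldsymbol{\theta}}\boldsymbol{u}_{\boldsymbol{\theta}}^Tf_{\boldsymbol{\theta}}^{1+\beta}d\boldsymbol{x}$, $\boldsymbol{K}_\beta(\boldsymbol{\theta})=\int\boldsymbol{u}_{\boldsymbol{\theta}}\boldsymbol{u}_{\boldsymbol{\theta}}^Tf_{\boldsymbol{\theta}}^{1+2\beta}d\boldsymbol{x}-\boldsymbol{\xi}_\beta(\boldsymbol{\theta})\boldsymbol{\xi}_\beta^T(\boldsymbol{\theta})$, $\boldsymbol{\Sigma}_\beta(\boldsymbol{\theta})=\boldsymbol{J}_\beta^{-1}(\boldsymbol{\theta})\boldsymbol{K}_\beta(\boldsymbol{\theta})\boldsymbol{J}_\beta^{-1}(\boldsymbol{\theta})$; the matrices whose inverses appear are invertible. The minimum density power divergence functional $\boldsymbol{T}_\beta(G)$ is the minimizer over $\boldsymbol{\theta}\in\Theta$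 of $\int f_{\boldsymbol{\theta}}^{1+\beta}d\boldsymbol{x}-(1+\frac1\beta)\int f_{\boldsymbol{\theta}}^\beta dG$ if $\beta>0$, and of $-\int\log f_{\boldsymbol{\theta}}\,dG$ if $\beta=0$. It is Fisher consistent: $\boldsymbol{T}_\beta(F_{\boldsymbol{\theta}_0})=\boldsymbol{\theta}_0$. For a functional $S$, let $F_\varepsilon=(1-\varepsilon)F_{\boldsymbol{\theta}_0}+\varepsilon\Delta_{\boldsymbol{x}}$, with $\Delta_{\boldsymbol{x}}$ the point mass at $\boldsymbol{x}$; the influence function is $\mathcal{IF}(\boldsymbol{x},S,F_{\boldsymbol{\theta}_0})=\frac{\partial}{\partial\varepsilon}S(F_\varepsilon)|_{\varepsilon=0}$ and the second order influence function is $\mathcal{IF}_2(\boldsymbol{x},S,F_{\boldsymbol{\theta}_0})=\frac{\partial^2}{\partial\varepsilon^2}S(F_\varepsilon)|_{\varepsilon=0}$. It is a known standing fact that $\mathcal{IF}(\boldsymbol{x},\boldsymbol{T}_\beta,F_{\boldsymbol{\theta}_0})=\boldsymbol{J}_\beta^{-1}(\boldsymbol{\theta}_0)(\boldsymbol{u}_{\boldsymbol{\theta}_0}(\boldsymbol{x})f_{\boldsymbol{\theta}_0}^\beta(\boldsymbol{x})-\boldsymbol{\xi}_\beta(\boldsymbol{\theta}_0))$. It is understood that $\varepsilon\mapsto\boldsymbol{T}_\beta(F_\varepsilon)$, $\varepsilon\mapsto\boldsymbol{M}(\boldsymbol{T}_\beta(F_\varepsilon))$ and $\varepsilon\mapsto\boldsymbol{\Sigma}_\beta(\boldsymbol{T}_\beta(F_\varepsilon))$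 are twice differentiable at $\varepsilon=0$. For the composite hypothesis: $\boldsymbol{m}:\mathbb{R}^p\to\mathbb{R}^r$ with $r\le p$; the $p\times r$ matrix $\boldsymbol{M}(\boldsymbol{\theta})=\partial\boldsymbol{m}^T(\boldsymbol{\theta})/\partial\boldsymbol{\theta}$ exists and is continuous in a neighbourhood of $\boldsymbol{\theta}_0$, and $\operatorname{rank}\boldsymbol{M}(\boldsymbol{\theta}_0)=r$. *)

theory Defs
  imports "HOL-Probability.Probability"
begin

section \<open>Contamination and influence functions\<close>

definition contamination :: "'x measure \<Rightarrow> 'x \<Rightarrow> real \<Rightarrow> 'x measure" where
  "contamination F x \<epsilon> = measure_of (space F) (sets F)
     (\<lambda>A. ennreal (1 - \<epsilon>) * emeasure F A + ennreal \<epsilon> * emeasure (return F x) A)"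

lemma space_contamination [simp]: "space (contamination F x \<epsilon>) = space F"
  by (simp add: contamination_def space_measure_of_conv)

lemma sets_contamination [simp]: "sets (contamination F x \<epsilon>) = sets F"
  by (simp add: contamination_def)

lemma emeasure_contamination:
  assumes "A \<in> sets F"
  shows "emeasure (contamination F x \<epsilon>) A
    = ennreal (1 - \<epsilon>) * emeasure F A + ennreal \<epsilon> * indicator A x"
proof -
  have "countably_additive (sets F)
     (\<lambda>A. ennreal (1 - \<epsilon>) * emeasure F A + ennreal \<epsilon> * emeasure (return F x) A)"
  proof (rule countably_additiveI)
    fix B :: "nat \<Rightarrow> 'a set"
    assume B: "range B \<subseteq> sets F" "disjoint_family B" "\<Union> (range B) \<in> sets F"
    then show "(\<Sum>i. ennreal (1 - \<epsilon>) * emeasure F (B i) + ennreal \<epsilon> * emeasure (return F x) (B i))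
      = ennreal (1 - \<epsilon>) * emeasure F (\<Union> (range B))
        + ennreal \<epsilon> * emeasure (return F x) (\<Union> (range B))"
      using suminf_emeasure[of B F] suminf_emeasure[of B "return F x"]
      by (simp add: suminf_add[symmetric] ennreal_suminf_cmult)
  qed
  then have "emeasure (contamination F x \<epsilon>) A
    = ennreal (1 - \<epsilon>) * emeasure F A + ennreal \<epsilon> * emeasure (return F x) A"
    unfolding contamination_def using assms
    by (intro emeasure_measure_of_sigma) (auto simp: positive_def sets.sigma_algebra_axioms)
  then show ?thesis using assms by simp
qed

lemma contamination_0 [simp]: "contamination F x 0 = F"
  by (rule measure_eqI) (simp_all add: emeasure_contamination)

text \<open>The contaminated distribution is a measure only for contamination proportions in
  \<open>[0, 1]\<close>, so derivatives at \<open>0\<close> are one-sided; at interior points of \<open>[0, 1]\<close>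
  the relative derivative is the ordinary one.\<close>

definition influence :: "'x \<Rightarrow> ('x measure \<Rightarrow> 'b::real_normed_vector) \<Rightarrow> 'x measure \<Rightarrow> 'b" where
  "influence x S F = vector_derivative (\<lambda>\<epsilon>. S (contamination F x \<epsilon>)) (at 0 within {0..1})"

definition influence2 :: "'x \<Rightarrow> ('x measure \<Rightarrow> 'b::real_normed_vector) \<Rightarrow> 'x measure \<Rightarrow> 'b" where
  "influence2 x S F =
     vector_derivative
       (\<lambda>\<epsilon>. vector_derivative (\<lambda>\<delta>. S (contamination F x \<delta>)) (at \<epsilon> within {0..1}))
       (at 0 within {0..1})"

definition twice_differentiable_within ::
    "(real \<Rightarrow> 'b::real_normed_vector) \<Rightarrow> real \<Rightarrow> real set \<Rightarrow> bool" where
  "twice_differentiable_within h t A \<longleftrightarrow>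
     h differentiable (at t within A) \<and>
     (\<forall>\<^sub>F s in at t within A. h differentiable (at s within A)) \<and>
     (\<lambda>s. vector_derivative h (at s within A)) differentiable (at t within A)"


section \<open>Parametric model\<close>

definition partial_deriv :: "'p::finite \<Rightarrow> (real^'p \<Rightarrow> real) \<Rightarrow> real^'p \<Rightarrow> real" where
  "partial_deriv i g \<theta> = deriv (\<lambda>t. g (\<theta> + t *\<^sub>R axis i 1)) 0"

definition model_dist ::
    "'x measure \<Rightarrow> (real^'p \<Rightarrow> 'x \<Rightarrow> real) \<Rightarrow> real^'p \<Rightarrow> 'x measure" where
  "model_dist \<nu> f \<theta> = density \<nu> (\<lambda>y. ennreal (f \<theta> y))"

definition score :: "(real^'p::finite \<Rightarrow> 'x \<Rightarrow> real) \<Rightarrow> real^'p \<Rightarrow> 'x \<Rightarrow> real^'p" where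
  "score f \<theta> y = (\<chi> i. partial_deriv i (\<lambda>\<eta>. ln (f \<eta> y)) \<theta>)"

definition outer :: "real^'n::finite \<Rightarrow> real^'m::finite \<Rightarrow> real^'m^'n" where
  "outer v w = (\<chi> i j. v $ i * w $ j)"

definition xi_vec ::
    "'x measure \<Rightarrow> (real^'p::finite \<Rightarrow> 'x \<Rightarrow> real) \<Rightarrow> real \<Rightarrow> real^'p \<Rightarrow> real^'p" where
  "xi_vec \<nu> f \<beta> \<theta> = (\<integral>y. (f \<theta> y powr (1 + \<beta>)) *\<^sub>R score f \<theta> y \<partial>\<nu>)"

definition J_mat ::
    "'x measure \<Rightarrow> (real^'p::finite \<Rightarrow> 'x \<Rightarrow> real) \<Rightarrow> real \<Rightarrow> real^'p \<Rightarrow> real^'p^'p" where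
  "J_mat \<nu> f \<beta> \<theta> =
     (\<integral>y. (f \<theta> y powr (1 + \<beta>)) *\<^sub>R outer (score f \<theta> y) (score f \<theta> y) \<partial>\<nu>)"

definition K_mat ::
    "'x measure \<Rightarrow> (real^'p::finite \<Rightarrow> 'x \<Rightarrow> real) \<Rightarrow> real \<Rightarrow> real^'p \<Rightarrow> real^'p^'p" where
  "K_mat \<nu> f \<beta> \<theta> =
     (\<integral>y. (f \<theta> y powr (1 + 2 * \<beta>)) *\<^sub>R outer (score f \<theta> y) (score f \<theta> y) \<partial>\<nu>)
     - outer (xi_vec \<nu> f \<beta> \<theta>) (xi_vec \<nu> f \<beta> \<theta>)"

definition Sigma_mat ::
    "'x measure \<Rightarrow> (real^'p::finite \<Rightarrow> 'x \<Rightarrow> real) \<Rightarrow> real \<Rightarrow> real^'p \<Rightarrow> real^'p^'p" where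
  "Sigma_mat \<nu> f \<beta> \<theta> =
     matrix_inv (J_mat \<nu> f \<beta> \<theta>) ** K_mat \<nu> f \<beta> \<theta> ** matrix_inv (J_mat \<nu> f \<beta> \<theta>)"


section \<open>The minimum density power divergence functional\<close>

text \<open>The objective is extended-real valued, because its integrals may be infinite for some
  parameter values. In the case \<open>\<beta> = 0\<close> the integral of \<open>- log f\<close> is split into the
  integrals of its negative and positive parts (\<open>ennreal\<close> truncates negative reals to
  \<open>0\<close>), with the convention \<open>- log 0 = \<infinity>\<close>, whereas \<open>ln 0 = 0\<close> in the library.
  Undefined differences \<open>\<infinity> - \<infinity>\<close> evaluate to \<open>\<infinity>\<close>.\<close>

definition dpd_objective ::
    "'x measure \<Rightarrow> (real^'p \<Rightarrow> 'x \<Rightarrow> real) \<Rightarrow> real \<Rightarrow> 'x measure \<Rightarrow> real^'p \<Rightarrow> ereal" where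
  "dpd_objective \<nu> f \<beta> G \<theta> =
     (if \<beta> = 0 then
        enn2ereal (\<integral>\<^sup>+y. (if f \<theta> y = 0 then \<infinity> else ennreal (- ln (f \<theta> y))) \<partial>G)
        - enn2ereal (\<integral>\<^sup>+y. ennreal (ln (f \<theta> y)) \<partial>G)
      else
        enn2ereal (\<integral>\<^sup>+y. ennreal (f \<theta> y powr (1 + \<beta>)) \<partial>\<nu>)
        - ereal (1 + 1 / \<beta>) * enn2ereal (\<integral>\<^sup>+y. ennreal (f \<theta> y powr \<beta>) \<partial>G))"

definition mdpd ::
    "'x measure \<Rightarrow> (real^'p \<Rightarrow> 'x \<Rightarrow> real) \<Rightarrow> (real^'p) set \<Rightarrow> real \<Rightarrow> 'x measure \<Rightarrow> real^'p" where
  "mdpd \<nu> f \<Theta> \<beta> G = (THE \<theta>. is_arg_min (dpd_objective \<nu> f \<beta> G) (\<lambda>\<theta>. \<theta> \<in> \<Theta>) \<theta>)"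


section \<open>Wald-type test functionals\<close>

definition wald_simple ::
    "'x measure \<Rightarrow> (real^'p::finite \<Rightarrow> 'x \<Rightarrow> real) \<Rightarrow> (real^'p) set \<Rightarrow> real \<Rightarrow> real^'p
      \<Rightarrow> 'x measure \<Rightarrow> real" where
  "wald_simple \<nu> f \<Theta> \<beta> \<theta>0 G =
     (mdpd \<nu> f \<Theta> \<beta> G - \<theta>0) \<bullet>
       (matrix_inv (Sigma_mat \<nu> f \<beta> \<theta>0) *v (mdpd \<nu> f \<Theta> \<beta> G - \<theta>0))"

definition M_mat :: "(real^'p::finite \<Rightarrow> real^'r::finite) \<Rightarrow> real^'p \<Rightarrow> real^'r^'p" where
  "M_mat m \<theta> = (\<chi> i j. partial_deriv i (\<lambda>\<eta>. m \<eta> $ j) \<theta>)"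

definition M_exists_at :: "(real^'p::finite \<Rightarrow> real^'r::finite) \<Rightarrow> real^'p \<Rightarrow> bool" where
  "M_exists_at m \<theta> \<longleftrightarrow>
     (\<forall>i j. (\<lambda>t. m (\<theta> + t *\<^sub>R axis i 1) $ j) field_differentiable (at 0))"

definition Sigma_star ::
    "'x measure \<Rightarrow> (real^'p::finite \<Rightarrow> 'x \<Rightarrow> real) \<Rightarrow> real \<Rightarrow> (real^'p \<Rightarrow> real^'r::finite)
      \<Rightarrow> real^'p \<Rightarrow> real^'r^'r" where
  "Sigma_star \<nu> f \<beta> m \<theta> = transpose (M_mat m \<theta>) ** Sigma_mat \<nu> f \<beta> \<theta> ** M_mat m \<theta>"

definition wald_composite ::
    "'x measure \<Rightarrow> (real^'p::finite \<Rightarrow> 'x \<Rightarrow> real) \<Rightarrow> (real^'p) set \<Rightarrow> real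
      \<Rightarrow> (real^'p \<Rightarrow> real^'r::finite) \<Rightarrow> 'x measure \<Rightarrow> real" where
  "wald_composite \<nu> f \<Theta> \<beta> m G =
     m (mdpd \<nu> f \<Theta> \<beta> G) \<bullet>
       (matrix_inv (Sigma_star \<nu> f \<beta> m (mdpd \<nu> f \<Theta> \<beta> G)) *v m (mdpd \<nu> f \<Theta> \<beta> G))"

end

theory Submission
  imports Defs
begin

text \<open>
  Both statistics have the form \<open>W = g \<bullet> (B g)\<close> along the contamination path
  \<open>\<epsilon> \<mapsto> T(F\<^sub>\<epsilon>)\<close>, with \<open>g(0) = 0\<close> by Fisher consistency and the null hypothesis: for the
  simple hypothesis \<open>g = T - \<theta>0\<close> and \<open>B\<close> is constant, for the composite one \<open>g = m(T)\<close> and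
  \<open>B\<close> is the inverse of \<open>M\<^sup>T \<Sigma> M\<close> at \<open>T\<close>. Expanding the second derivative of the
  product, every term except \<open>2 g'(0) \<bullet> (B(0) g'(0))\<close> carries an undifferentiated factor
  \<open>g(0) = 0\<close> (\<open>has_two_derivatives_quadratic_form\<close>). Here \<open>g'(0)\<close> is \<open>J\<^sup>-\<^sup>1 v\<close>, the
  influence function of \<open>T\<close>, respectively \<open>M\<^sup>T J\<^sup>-\<^sup>1 v\<close> by the chain rule. Moving one factor
  \<open>J\<^sup>-\<^sup>1\<close> across the inner product, which uses that \<open>J\<close> is symmetric, gives the stated forms.

  The substance lies in the existence of these derivatives. The matrix \<open>B\<close> is twice
  differentiable along the path because inversion has the derivative
  \<open>H \<mapsto> - X\<^sup>-\<^sup>1 H X\<^sup>-\<^sup>1\<close> (\<open>has_derivative_matrix_inv\<close>), which is again a product of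
  differentiable factors (\<open>has_two_derivatives_matrix_inv\<close>). The map \<open>m\<close> is only known to have
  continuous partial derivatives, so it is Frechet differentiable near \<open>\<theta>0\<close>
  (\<open>has_derivative_continuous_partials\<close>) but need not be twice differentiable; still
  \<open>(m \<circ> T)' = M(T)\<^sup>T T'\<close> near \<open>0\<close>, and both factors are differentiable at \<open>0\<close>
  (\<open>has_two_derivatives_compose\<close>).
\<close>

section \<open>First and second derivatives along a curve\<close>

text \<open>The first derivative is required on a whole neighbourhood of \<open>t\<close> relative to \<open>A\<close>, the
  second at \<open>t\<close> only. Naming \<open>h'\<close> as an explicit function, in place of the choice made by
  \<open>vector_derivative\<close>, is what lets the calculus rules below compose.\<close>

definition has_two_derivatives ::
    "(real \<Rightarrow> 'b::real_normed_vector) \<Rightarrow> (real \<Rightarrow> 'b) \<Rightarrow> 'b \<Rightarrow> real \<Rightarrow> real set \<Rightarrow> bool" where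
  "has_two_derivatives h h' h'' t A \<longleftrightarrow>
     (\<forall>\<^sub>F s in nhds t. s \<in> A \<longrightarrow> (h has_vector_derivative h' s) (at s within A)) \<and>
     (h' has_vector_derivative h'') (at t within A)"

lemma has_two_derivativesD:
  assumes "has_two_derivatives h h' h'' t A" "t \<in> A"
  shows "(h has_vector_derivative h' t) (at t within A)"
  using assms by (auto simp: has_two_derivatives_def dest: eventually_nhds_x_imp_x)

lemma has_two_derivativesD2:
  assumes "has_two_derivatives h h' h'' t A"
  shows "(h' has_vector_derivative h'') (at t within A)"
  using assms by (auto simp: has_two_derivatives_def)

lemma twice_differentiable_withinD:
  assumes "twice_differentiable_within h t A" "t \<in> A"
  shows "\<exists>h''. has_two_derivatives h (\<lambda>s. vector_derivative h (at s within A)) h'' t A"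
proof -
  have 1: "h differentiable (at t within A)"
    and 2: "\<forall>\<^sub>F s in at t within A. h differentiable (at s within A)"
    and 3: "(\<lambda>s. vector_derivative h (at s within A)) differentiable (at t within A)"
    using assms by (auto simp: twice_differentiable_within_def)
  from 2 have "\<forall>\<^sub>F s in nhds t. s \<noteq> t \<longrightarrow> s \<in> A \<longrightarrow> h differentiable (at s within A)"
    by (simp add: eventually_at_filter)
  then have "\<forall>\<^sub>F s in nhds t. s \<in> A \<longrightarrow>
      (h has_vector_derivative vector_derivative h (at s within A)) (at s within A)"
    by eventually_elim (use 1 in \<open>auto simp: vector_derivative_works\<close>)
  with 3 show ?thesis
    by (auto simp: has_two_derivatives_def vector_derivative_works)
qed

text \<open>At every limit point of \<open>A\<close> the derivative within \<open>A\<close> is unique, so near \<open>t\<close> the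
  function \<open>h'\<close> agrees with the iterated \<open>vector_derivative\<close> in the definition of the
  second order influence function.\<close>

lemma has_two_derivatives_unique:
  assumes h: "has_two_derivatives h h' h'' t A" and t: "t \<in> A"
    and lim: "\<And>s. s \<in> A \<Longrightarrow> at s within A \<noteq> bot"
  shows "twice_differentiable_within h t A"
    and "vector_derivative (\<lambda>s. vector_derivative h (at s within A)) (at t within A) = h''"
proof -
  let ?D = "\<lambda>s. vector_derivative h (at s within A)"
  have ev: "\<forall>\<^sub>F s in nhds t. s \<in> A \<longrightarrow> (h has_vector_derivative h' s) (at s within A)"
    and h': "(h' has_vector_derivative h'') (at t within A)"
    using h by (auto simp: has_two_derivatives_def)
  have "\<forall>\<^sub>F s in nhds t. s \<in> A \<longrightarrow> h' s = ?D s"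
    using ev by eventually_elim (auto simp: vector_derivative_within lim)
  then obtain d where d: "d > 0" "\<And>s. s \<in> A \<Longrightarrow> dist s t < d \<Longrightarrow> h' s = ?D s"
    by (auto simp: eventually_nhds_metric)
  have D: "(?D has_vector_derivative h'') (at t within A)"
    by (rule has_vector_derivative_transform_within[OF h' d(1) t d(2)])
  show "vector_derivative ?D (at t within A) = h''"
    by (rule vector_derivative_within[OF lim[OF t] D])
  have ev': "\<forall>\<^sub>F s in nhds t. s \<in> A \<longrightarrow> h differentiable (at s within A)"
    using ev by eventually_elim (auto simp: differentiableI_vector)
  then have "\<forall>\<^sub>F s in at t within A. h differentiable (at s within A)"
    by (auto simp: eventually_at_filter elim: eventually_mono)
  moreover have "h differentiable (at t within A)"
    using eventually_nhds_x_imp_x[OF ev'] t by simp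
  ultimately show "twice_differentiable_within h t A"
    using D by (auto simp: twice_differentiable_within_def differentiableI_vector)
qed

lemma has_two_derivatives_const: "has_two_derivatives (\<lambda>_. c) (\<lambda>_. 0) 0 t A"
  by (simp add: has_two_derivatives_def)

lemma has_two_derivatives_diff_const:
  assumes "has_two_derivatives h h' h'' t A"
  shows "has_two_derivatives (\<lambda>s. h s - c) h' h'' t A"
  using assms unfolding has_two_derivatives_def
  by (auto elim!: eventually_mono intro: has_vector_derivative_diff_const[THEN iffD2])

lemma (in bounded_linear) has_two_derivatives:
  assumes "has_two_derivatives h h' h'' t A"
  shows "has_two_derivatives (\<lambda>s. f (h s)) (\<lambda>s. f (h' s)) (f h'') t A"
  using assms unfolding has_two_derivatives_def
  by (auto elim!: eventually_mono intro: has_vector_derivative)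

lemma has_two_derivatives_bilinear:
  assumes P: "bounded_bilinear P"
    and f: "has_two_derivatives f f' f'' t A" and g: "has_two_derivatives g g' g'' t A"
    and t: "t \<in> A"
  shows "has_two_derivatives (\<lambda>s. P (f s) (g s)) (\<lambda>s. P (f s) (g' s) + P (f' s) (g s))
           (P (f t) g'' + 2 *\<^sub>R P (f' t) (g' t) + P f'' (g t)) t A"
proof -
  note [intro] = bounded_bilinear.has_vector_derivative[OF P]
  have "\<forall>\<^sub>F s in nhds t. s \<in> A \<longrightarrow>
      ((\<lambda>s. P (f s) (g s)) has_vector_derivative P (f s) (g' s) + P (f' s) (g s)) (at s within A)"
    using f[unfolded has_two_derivatives_def, THEN conjunct1]
      g[unfolded has_two_derivatives_def, THEN conjunct1]
    by eventually_elim auto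
  moreover have "((\<lambda>s. P (f s) (g' s) + P (f' s) (g s)) has_vector_derivative
      (P (f t) g'' + P (f' t) (g' t)) + (P (f' t) (g' t) + P f'' (g t))) (at t within A)"
    using f g t
    by (intro has_vector_derivative_add bounded_bilinear.has_vector_derivative[OF P])
      (auto intro: has_two_derivativesD has_two_derivativesD2)
  ultimately show ?thesis
    by (simp add: has_two_derivatives_def scaleR_2 add_ac)
qed

lemma bounded_bilinear_matrix_matrix_mult:
  "bounded_bilinear ((**) :: real^'n^'m \<Rightarrow> real^'p^'n \<Rightarrow> real^'p^'m)"
  unfolding bilinear_conv_bounded_bilinear[symmetric]
  by (auto simp: bilinear_def matrix_matrix_mult_def vec_eq_iff sum.distrib sum_distrib_left
      algebra_simps intro!: linearI)

lemma bounded_bilinear_matrix_vector_mult: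
  "bounded_bilinear ((*v) :: real^'n^'m \<Rightarrow> real^'n \<Rightarrow> real^'m)"
  unfolding bilinear_conv_bounded_bilinear[symmetric]
  by (auto simp: bilinear_def matrix_vector_mult_def vec_eq_iff sum.distrib sum_distrib_left
      algebra_simps intro!: linearI)

lemma bounded_linear_transpose:
  "bounded_linear (transpose :: real^'n^'m \<Rightarrow> real^'m^'n)"
  unfolding linear_conv_bounded_linear[symmetric]
  by (auto simp: transpose_def vec_eq_iff intro!: linearI)

text \<open>Where \<open>g\<close> vanishes, the product rule keeps only the term that differentiates both
  occurrences of \<open>g\<close>: every other term has the factor \<open>g t\<close>.\<close>

lemma has_two_derivatives_quadratic_form:
  fixes g :: "real \<Rightarrow> real^'n" and B :: "real \<Rightarrow> real^'n^'n"
  assumes g: "has_two_derivatives g g' g'' t A" and B: "has_two_derivatives B B' B'' t A"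
    and t: "t \<in> A" and g0: "g t = 0"
  shows "\<exists>h'. has_two_derivatives (\<lambda>s. g s \<bullet> (B s *v g s)) h'
           (2 * (g' t \<bullet> (B t *v g' t))) t A"
proof -
  note mv = bounded_bilinear_matrix_vector_mult
  show ?thesis
    using has_two_derivatives_bilinear[OF bounded_bilinear_inner g
        has_two_derivatives_bilinear[OF mv B g t] t]
    by (auto simp: g0)
qed


section \<open>Differentiability of the matrix inverse\<close>

lemma matrix_inv_mult:
  fixes X :: "real^'n^'n"
  assumes "invertible X"
  shows "X ** matrix_inv X = mat 1" and "matrix_inv X ** X = mat 1"
  using someI_ex[OF assms[unfolded invertible_def]] by (auto simp: matrix_inv_def)

lemma matrix_inv_transpose:
  fixes X :: "real^'n^'n"
  assumes "invertible X"
  shows "matrix_inv (transpose X) = transpose (matrix_inv X)"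
proof -
  have 1: "transpose X ** transpose (matrix_inv X) = mat 1"
    by (metis assms matrix_inv_mult(2) matrix_transpose_mul transpose_mat)
  have "invertible (transpose X)"
    using assms by (rule transpose_invertible)
  then show ?thesis
    by (metis 1 matrix_inv_mult(2) matrix_mul_assoc matrix_mul_lid matrix_mul_rid)
qed

lemma continuous_on_det: "continuous_on S (det :: real^'n^'n \<Rightarrow> real)"
  unfolding det_def[abs_def] by (intro continuous_intros)

lemma open_invertible: "open {X :: real^'n^'n. invertible X}"
proof -
  have "open {X :: real^'n^'n. det X \<noteq> 0}"
    by (intro open_Collect_neq continuous_on_det continuous_on_const)
  then show ?thesis
    by (simp add: invertible_det_nz)
qed

text \<open>Cramer's rule presents the entries of the inverse as quotients of polynomials, which makes
  inversion continuous.\<close>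

lemma matrix_inv_cramer:
  fixes X :: "real^'n^'n"
  assumes "invertible X"
  shows "matrix_inv X $ k $ j =
    det (\<chi> i l. if l = k then axis j 1 $ i else X $ i $ l) / det X"
proof -
  have "X *v (matrix_inv X *v axis j 1) = axis j 1"
    by (simp add: matrix_vector_mul_assoc matrix_inv_mult assms)
  then have "matrix_inv X *v axis j 1 =
      (\<chi> k. det (\<chi> i l. if l = k then axis j 1 $ i else X $ i $ l) / det X)"
    using cramer[of X "matrix_inv X *v axis j 1" "axis j 1"] assms
    by (simp add: invertible_det_nz)
  then show ?thesis
    by (simp add: matrix_vector_mult_basis column_def vec_eq_iff)
qed

lemma continuous_on_matrix_inv:
  "continuous_on {X. invertible X} (matrix_inv :: real^'n^'n \<Rightarrow> real^'n^'n)"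
proof -
  have "continuous_on {X. invertible X} (\<lambda>X :: real^'n^'n. matrix_inv X $ k $ j)" for k j
  proof (rule continuous_on_eq)
    have "continuous_on {X. invertible X}
        (\<lambda>X :: real^'n^'n. if l = k then axis j 1 $ i else X $ i $ l)" for i l
      by (cases "l = k") (auto intro!: continuous_intros)
    then show "continuous_on {X. invertible X} (\<lambda>X :: real^'n^'n.
        det (\<chi> i l. if l = k then axis j 1 $ i else X $ i $ l) / det X)"
      by (intro continuous_on_divide continuous_on_det
          continuous_on_compose2[OF continuous_on_det[of UNIV]] continuous_on_vec_lambda)
        (auto simp: invertible_det_nz)
  qed (simp add: matrix_inv_cramer)
  then have "continuous_on {X. invertible X} (\<lambda>X :: real^'n^'n. \<chi> k j. matrix_inv X $ k $ j)"
    by (intro continuous_on_vec_lambda)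
  then show ?thesis
    by simp
qed

text \<open>The error of the linear approximation is itself a product: with \<open>H = Y - X\<close> it equals
  \<open>(X\<^sup>-\<^sup>1 - Y\<^sup>-\<^sup>1) H X\<^sup>-\<^sup>1\<close>, which is \<open>o(H)\<close> as soon as inversion is continuous.\<close>

lemma has_derivative_matrix_inv:
  fixes X :: "real^'n^'n"
  assumes X: "invertible X"
  shows "(matrix_inv has_derivative (\<lambda>H. - (matrix_inv X ** H ** matrix_inv X))) (at X)"
proof -
  interpret b: bounded_bilinear "(**) :: real^'n^'n \<Rightarrow> real^'n^'n \<Rightarrow> real^'n^'n"
    by (rule bounded_bilinear_matrix_matrix_mult)
  let ?R = "matrix_inv X"
  obtain K where K: "K > 0"
      "\<And>a b. norm ((a :: real^'n^'n) ** (b :: real^'n^'n)) \<le> norm a * norm b * K"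
    using b.pos_bounded by blast
  have bl: "bounded_linear (\<lambda>H. - (?R ** H ** ?R))"
    by (intro bounded_linear_minus b.bounded_linear_left[THEN bounded_linear_compose]
        b.bounded_linear_right)
  have cont: "isCont (matrix_inv :: real^'n^'n \<Rightarrow> _) X"
    using bspec[OF iffD1[OF continuous_on_eq_continuous_at[OF open_invertible]
          continuous_on_matrix_inv], of X] X by simp
  obtain r where r: "r > 0" "\<And>Y. norm (Y - X) < r \<Longrightarrow> invertible Y"
    using open_invertible X unfolding open_dist by (auto simp: dist_norm)
  show ?thesis
    unfolding has_derivative_at_alt
  proof (intro conjI allI impI bl)
    fix e :: real assume e: "e > 0"
    \<comment> \<open>The factor \<open>K\<close> enters once for each of the two products; adding \<open>1\<close> keeps the
      denominator positive.\<close>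
    define c where "c = e / (K * K * (norm ?R + 1))"
    have pos: "K * K * (norm ?R + 1) > 0"
      using K(1) by (intro mult_pos_pos) (auto intro: add_nonneg_pos)
    have c: "c > 0"
      using e pos by (simp add: c_def)
    obtain d where d: "d > 0" "\<And>Y. norm (Y - X) < d \<Longrightarrow> norm (matrix_inv Y - ?R) < c"
      using cont c unfolding continuous_at_eps_delta by (auto simp: dist_norm)
    show "\<exists>d>0. \<forall>Y. norm (Y - X) < d \<longrightarrow>
        norm (matrix_inv Y - ?R - - (?R ** (Y - X) ** ?R)) \<le> e * norm (Y - X)"
    proof (intro exI[of _ "min d r"] conjI allI impI)
      fix Y assume Y: "norm (Y - X) < min d r"
      then have inv: "invertible Y" using r by simp
      have "(?R - matrix_inv Y) ** (Y - X) ** ?R =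
          ?R ** (Y - X) ** ?R - (matrix_inv Y ** Y) ** ?R + matrix_inv Y ** (X ** ?R)"
        by (simp add: b.diff_left b.diff_right matrix_mul_assoc)
      also have "\<dots> = matrix_inv Y - ?R - - (?R ** (Y - X) ** ?R)"
        by (simp add: matrix_inv_mult inv X)
      finally have "norm (matrix_inv Y - ?R - - (?R ** (Y - X) ** ?R))
          = norm ((?R - matrix_inv Y) ** (Y - X) ** ?R)" by simp
      also have "\<dots> \<le> norm ((?R - matrix_inv Y) ** (Y - X)) * norm ?R * K"
        by (rule K(2))
      also have "\<dots> \<le> (norm (?R - matrix_inv Y) * norm (Y - X) * K) * norm ?R * K"
        by (intro mult_right_mono K(2)) (use K in auto)
      also have "\<dots> \<le> (c * norm (Y - X) * K) * (norm ?R + 1) * K"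
        using d(2)[of Y] Y c K(1)
        by (intro mult_mono mult_nonneg_nonneg) (auto simp: norm_minus_commute)
      also have "\<dots> = c * (K * K * (norm ?R + 1)) * norm (Y - X)"
        by (simp only: mult_ac)
      also have "c * (K * K * (norm ?R + 1)) = e"
        unfolding c_def using pos by (intro nonzero_eq_divide_eq[THEN iffD1]) auto
      finally show "norm (matrix_inv Y - ?R - - (?R ** (Y - X) ** ?R)) \<le> e * norm (Y - X)" .
    qed (use d r in auto)
  qed
qed

text \<open>The derivative \<open>- S\<^sup>-\<^sup>1 S' S\<^sup>-\<^sup>1\<close> is a product of functions that are differentiable at
  \<open>t\<close>, so the product rule yields the second derivative from the first.\<close>

lemma has_two_derivatives_matrix_inv:
  fixes S :: "real \<Rightarrow> real^'n^'n"
  assumes S: "has_two_derivatives S S' S'' t A" and t: "t \<in> A" and inv: "invertible (S t)"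
  shows "\<exists>R' R''. has_two_derivatives (\<lambda>s. matrix_inv (S s)) R' R'' t A"
proof -
  interpret b: bounded_bilinear "(**) :: real^'n^'n \<Rightarrow> real^'n^'n \<Rightarrow> real^'n^'n"
    by (rule bounded_bilinear_matrix_matrix_mult)
  let ?R = "\<lambda>s. matrix_inv (S s)"
  let ?R' = "\<lambda>s. - (?R s ** S' s ** ?R s)"
  have R: "(?R has_vector_derivative ?R' s) (at s within A)"
    if "(S has_vector_derivative S' s) (at s within A)" "invertible (S s)" for s
    using vector_derivative_diff_chain_within[OF that(1)
        has_derivative_at_withinI[OF has_derivative_matrix_inv[OF that(2)]]]
    by (simp add: o_def)
  have "continuous (at t within A) S"
    using has_two_derivativesD[OF S t] by (rule has_vector_derivative_continuous)
  then have "\<forall>\<^sub>F s in at t within A. invertible (S s)"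
    using topological_tendstoD[OF _ open_invertible, of S "S t"] inv
    by (simp add: continuous_within)
  then have "\<forall>\<^sub>F s in nhds t. s \<noteq> t \<longrightarrow> s \<in> A \<longrightarrow> invertible (S s)"
    by (simp add: eventually_at_filter)
  with S[unfolded has_two_derivatives_def, THEN conjunct1]
  have "\<forall>\<^sub>F s in nhds t. s \<in> A \<longrightarrow> (?R has_vector_derivative ?R' s) (at s within A)"
    by eventually_elim (use inv in \<open>auto intro!: R\<close>)
  moreover obtain R'' where "(?R' has_vector_derivative R'') (at t within A)"
    using has_vector_derivative_minus[OF b.has_vector_derivative[OF b.has_vector_derivative
          [OF R[OF has_two_derivativesD[OF S t] inv] has_two_derivativesD2[OF S]]
          R[OF has_two_derivativesD[OF S t] inv]]] by blast
  ultimately show ?thesis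
    unfolding has_two_derivatives_def by (intro exI[of _ ?R'] exI[of _ R''] conjI)
qed


section \<open>Continuous partial derivatives\<close>

text \<open>Move from \<open>\<theta>\<close> to \<open>\<theta> + h\<close> one coordinate at a time. Each leg stays within distance
  \<open>norm h\<close> of \<open>\<theta>\<close>, where the partial derivatives differ from those at \<open>\<theta>\<close> by less than
  \<open>c\<close>, so by the mean value inequality it contributes an error of at most \<open>c * norm h\<close>.\<close>

lemma has_derivative_continuous_partials:
  fixes f :: "real^'n \<Rightarrow> 'b::real_normed_vector" and D :: "'n \<Rightarrow> real^'n \<Rightarrow> 'b"
  assumes partials: "\<forall>\<^sub>F \<eta> in nhds \<theta>. \<forall>i.
      ((\<lambda>t. f (\<eta> + t *\<^sub>R axis i 1)) has_vector_derivative D i \<eta>) (at 0)"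
    and cont: "\<And>i. isCont (D i) \<theta>"
  shows "(f has_derivative (\<lambda>h. \<Sum>i\<in>UNIV. h $ i *\<^sub>R D i \<theta>)) (at \<theta>)"
  unfolding has_derivative_at_alt
proof (intro conjI allI impI)
  show "bounded_linear (\<lambda>h. \<Sum>i\<in>UNIV. h $ i *\<^sub>R D i \<theta>)"
    by (intro bounded_linear_sum bounded_linear_compose[OF bounded_linear_scaleR_left]
        bounded_linear_vec_nth)
next
  fix e :: real assume e: "e > 0"
  \<comment> \<open>One share of \<open>e\<close> for each of the coordinate legs.\<close>
  define c where "c = e / CARD('n)"
  have c: "c > 0" using e by (simp add: c_def)
  have "\<forall>\<^sub>F \<eta> in nhds \<theta>. \<forall>i\<in>UNIV. dist (D i \<eta>) (D i \<theta>) < c"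
    using cont c by (intro eventually_ball_finite ballI)
      (auto simp: isCont_def tendsto_at_iff_tendsto_nhds intro: tendstoD)
  with partials have "\<forall>\<^sub>F \<eta> in nhds \<theta>. \<forall>i. norm (D i \<eta> - D i \<theta>) < c \<and>
      ((\<lambda>t. f (\<eta> + t *\<^sub>R axis i 1)) has_vector_derivative D i \<eta>) (at 0)"
    by eventually_elim (auto simp: dist_norm)
  then obtain d where d: "d > 0" and
    near: "\<And>\<eta> i. norm (\<eta> - \<theta>) < d \<Longrightarrow> norm (D i \<eta> - D i \<theta>) < c"
    and deriv: "\<And>\<eta> i. norm (\<eta> - \<theta>) < d \<Longrightarrow>
      ((\<lambda>t. f (\<eta> + t *\<^sub>R axis i 1)) has_vector_derivative D i \<eta>) (at 0)"
    by (auto simp: eventually_nhds_metric dist_norm)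
  have main: "norm (f (\<theta> + h) - f \<theta> - (\<Sum>i\<in>I. h $ i *\<^sub>R D i \<theta>)) \<le> card I * c * norm h"
    if "finite I" "norm h < d" "\<And>i. i \<notin> I \<Longrightarrow> h $ i = 0" for I h
    using that
  proof (induction I arbitrary: h rule: finite_induct)
    case empty
    then have "h = 0" by (simp add: vec_eq_iff)
    then show ?case by simp
  next
    case (insert j I)
    define k where "k = (\<chi> i. if i = j then 0 else h $ i)"
    have h: "h = k + h $ j *\<^sub>R axis j 1"
      by (simp add: k_def vec_eq_iff axis_def)
    have small: "norm (k + t *\<^sub>R axis j 1) \<le> norm h" if "\<bar>t\<bar> \<le> \<bar>h $ j\<bar>" for t
      using that by (intro norm_le_componentwise_cart) (auto simp: k_def axis_def)
    have k: "norm k \<le> norm h"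
      using small[of 0] by simp
    have "(\<Sum>i\<in>I. k $ i *\<^sub>R D i \<theta>) = (\<Sum>i\<in>I. h $ i *\<^sub>R D i \<theta>)"
      using insert.hyps by (intro sum.cong) (auto simp: k_def)
    with insert.IH[of k] k insert.prems
    have 1: "norm (f (\<theta> + k) - f \<theta> - (\<Sum>i\<in>I. h $ i *\<^sub>R D i \<theta>)) \<le> card I * c * norm k"
      by (auto simp: k_def)
    \<comment> \<open>Without its linear part, \<open>f\<close> varies along direction \<open>j\<close> with slope at most \<open>c\<close>.\<close>
    define \<phi> where "\<phi> t = f (\<theta> + k + t *\<^sub>R axis j 1) - t *\<^sub>R D j \<theta>" for t
    let ?pt = "\<lambda>t. \<theta> + k + t *\<^sub>R axis j 1"
    have pt: "norm (?pt t - \<theta>) < d" if "t \<in> closed_segment 0 (h $ j)" for t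
    proof -
      have "\<bar>t\<bar> \<le> \<bar>h $ j\<bar>"
        using that by (auto simp: closed_segment_eq_real_ivl split: if_splits)
      from small[OF this] insert.prems(1) show ?thesis
        by (simp add: add.assoc)
    qed
    have "norm (\<phi> (h $ j) - \<phi> 0) \<le> c * norm (h $ j - 0)"
    proof (rule differentiable_bound)
      show "convex (closed_segment 0 (h $ j))" by simp
      fix t assume t: "t \<in> closed_segment 0 (h $ j)"
      have shift: "((\<lambda>s. s - t) has_vector_derivative 1) (at t)"
        by (auto intro!: derivative_eq_intros)
      have "((\<lambda>s. f (?pt t + (s - t) *\<^sub>R axis j 1)) has_vector_derivative D j (?pt t)) (at t)"
        using vector_diff_chain_at[OF shift, of "\<lambda>u. f (?pt t + u *\<^sub>R axis j 1)"]
          deriv[OF pt[OF t], of j] by (simp add: o_def)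
      then have "((\<lambda>s. f (?pt s)) has_vector_derivative D j (?pt t)) (at t)"
        by (simp add: algebra_simps)
      then have "(\<phi> has_vector_derivative D j (?pt t) - D j \<theta>) (at t)"
        unfolding \<phi>_def by (auto intro!: derivative_eq_intros)
      then show "(\<phi> has_derivative (\<lambda>s. s *\<^sub>R (D j (?pt t) - D j \<theta>)))
          (at t within closed_segment 0 (h $ j))"
        unfolding has_vector_derivative_def by (rule has_derivative_at_withinI)
      show "onorm (\<lambda>s. s *\<^sub>R (D j (?pt t) - D j \<theta>)) \<le> c"
        using near[OF pt[OF t], of j] by (intro onorm_le)
          (simp add: mult.commute[of c] mult_left_mono)
    qed auto
    then have 2: "norm (f (\<theta> + h) - f (\<theta> + k) - h $ j *\<^sub>R D j \<theta>) \<le> c * \<bar>h $ j\<bar>"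
      using h by (simp add: \<phi>_def algebra_simps)
    have "norm (f (\<theta> + h) - f \<theta> - (\<Sum>i\<in>insert j I. h $ i *\<^sub>R D i \<theta>)) =
        norm ((f (\<theta> + k) - f \<theta> - (\<Sum>i\<in>I. h $ i *\<^sub>R D i \<theta>))
          + (f (\<theta> + h) - f (\<theta> + k) - h $ j *\<^sub>R D j \<theta>))"
      using insert.hyps by (simp add: algebra_simps)
    also have "\<dots> \<le> card I * c * norm k + c * \<bar>h $ j\<bar>"
      using 1 2 by (rule norm_triangle_mono)
    also have "\<dots> \<le> card I * c * norm h + c * norm h"
      using c k component_le_norm_cart[of h j]
      by (intro add_mono mult_left_mono) auto
    also have "\<dots> = card (insert j I) * c * norm h"
      using insert.hyps by (simp add: algebra_simps)
    finally show ?case .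
  qed
  show "\<exists>d>0. \<forall>\<eta>. norm (\<eta> - \<theta>) < d \<longrightarrow>
      norm (f \<eta> - f \<theta> - (\<Sum>i\<in>UNIV. (\<eta> - \<theta>) $ i *\<^sub>R D i \<theta>)) \<le> e * norm (\<eta> - \<theta>)"
  proof (intro exI[of _ d] conjI d allI impI)
    fix \<eta> assume "norm (\<eta> - \<theta>) < d"
    then show "norm (f \<eta> - f \<theta> - (\<Sum>i\<in>UNIV. (\<eta> - \<theta>) $ i *\<^sub>R D i \<theta>)) \<le> e * norm (\<eta> - \<theta>)"
      using main[of UNIV "\<eta> - \<theta>"] by (simp add: c_def)
  qed
qed

lemma has_derivative_M_mat:
  fixes m :: "real^'p \<Rightarrow> real^'r"
  assumes U: "open U" "\<theta> \<in> U" and ex: "\<And>\<eta>. \<eta> \<in> U \<Longrightarrow> M_exists_at m \<eta>"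
    and cont: "continuous_on U (M_mat m)"
  shows "(m has_derivative (\<lambda>h. transpose (M_mat m \<theta>) *v h)) (at \<theta>)"
proof -
  let ?D = "\<lambda>i \<eta>. M_mat m \<eta> $ i"
  have "((\<lambda>t. m (\<eta> + t *\<^sub>R axis i 1)) has_vector_derivative ?D i \<eta>) (at 0)"
    if "\<eta> \<in> U" for \<eta> i
  proof -
    have "((\<lambda>t. m (\<eta> + t *\<^sub>R axis i 1) $ j) has_vector_derivative ?D i \<eta> $ j) (at 0)" for j
      using ex[OF that] unfolding M_exists_at_def
      by (simp add: M_mat_def partial_deriv_def field_differentiable_derivI
          has_real_derivative_iff_has_vector_derivative[symmetric])
    then show ?thesis
      unfolding has_vector_derivative_def
      by (subst has_derivative_componentwise_within)
        (auto simp: Basis_vec_def inner_axis)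
  qed
  then have "\<forall>\<^sub>F \<eta> in nhds \<theta>. \<forall>i.
      ((\<lambda>t. m (\<eta> + t *\<^sub>R axis i 1)) has_vector_derivative ?D i \<eta>) (at 0)"
    using eventually_nhds_in_open[OF U] by (auto elim: eventually_mono)
  moreover have "isCont (?D i) \<theta>" for i
    using cont U by (intro continuous_intros) (simp add: continuous_on_eq_continuous_at)
  ultimately have "(m has_derivative (\<lambda>h. \<Sum>i\<in>UNIV. h $ i *\<^sub>R ?D i \<theta>)) (at \<theta>)"
    by (rule has_derivative_continuous_partials)
  also have "(\<lambda>h. \<Sum>i\<in>UNIV. h $ i *\<^sub>R ?D i \<theta>) = (\<lambda>h. transpose (M_mat m \<theta>) *v h)"
    by (auto simp: fun_eq_iff vec_eq_iff vector_matrix_mult_def mult.commute)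
  finally show ?thesis .
qed

text \<open>The composition is twice differentiable at \<open>t\<close> although \<open>m\<close> itself may be differentiable
  only once: near \<open>t\<close> its derivative is \<open>M(\<tau>) \<tau>'\<close>, and both factors are differentiable along
  the curve.\<close>

lemma has_two_derivatives_compose:
  fixes m :: "real^'p \<Rightarrow> real^'r" and M :: "real^'p \<Rightarrow> real^'p^'r"
  assumes \<tau>: "has_two_derivatives \<tau> \<tau>' \<tau>'' t A" and t: "t \<in> A"
    and U: "open U" "\<tau> t \<in> U"
    and m: "\<And>\<theta>. \<theta> \<in> U \<Longrightarrow> (m has_derivative (\<lambda>h. M \<theta> *v h)) (at \<theta>)"
    and M: "((\<lambda>s. M (\<tau> s)) has_vector_derivative N) (at t within A)"
  shows "has_two_derivatives (\<lambda>s. m (\<tau> s)) (\<lambda>s. M (\<tau> s) *v \<tau>' s)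
           (M (\<tau> t) *v \<tau>'' + N *v \<tau>' t) t A"
  unfolding has_two_derivatives_def
proof
  show "((\<lambda>s. M (\<tau> s) *v \<tau>' s) has_vector_derivative M (\<tau> t) *v \<tau>'' + N *v \<tau>' t)
      (at t within A)"
    by (rule bounded_bilinear.has_vector_derivative[OF bounded_bilinear_matrix_vector_mult
          M has_two_derivativesD2[OF \<tau>]])
  have "continuous (at t within A) \<tau>"
    using has_two_derivativesD[OF \<tau> t] by (rule has_vector_derivative_continuous)
  then have "\<forall>\<^sub>F s in at t within A. \<tau> s \<in> U"
    using topological_tendstoD[OF _ U] by (simp add: continuous_within)
  then have "\<forall>\<^sub>F s in nhds t. s \<noteq> t \<longrightarrow> s \<in> A \<longrightarrow> \<tau> s \<in> U"
    by (simp add: eventually_at_filter)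
  with \<tau>[unfolded has_two_derivatives_def, THEN conjunct1]
  show "\<forall>\<^sub>F s in nhds t. s \<in> A \<longrightarrow>
      ((\<lambda>s. m (\<tau> s)) has_vector_derivative M (\<tau> s) *v \<tau>' s) (at s within A)"
  proof eventually_elim
    case (elim s)
    show ?case
    proof
      assume s: "s \<in> A"
      then have "\<tau> s \<in> U" using elim U by blast
      from vector_derivative_diff_chain_within[OF elim(1)[rule_format, OF s]
          has_derivative_at_withinI[OF m[OF this]]]
      show "((\<lambda>s. m (\<tau> s)) has_vector_derivative M (\<tau> s) *v \<tau>' s) (at s within A)"
        by (simp add: o_def)
    qed
  qed
qed


section \<open>Influence functions of the Wald-type statistics\<close>

text \<open>The integrand is a multiple of \<open>u u\<^sup>T\<close>, and transposition commutes with the Bochner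
  integral; since it is an involution, both sides are \<open>0\<close> when the integral does not exist.\<close>

lemma transpose_J_mat:
  fixes f :: "real^'p \<Rightarrow> 'x \<Rightarrow> real"
  shows "transpose (J_mat \<nu> f \<beta> \<theta>) = J_mat \<nu> f \<beta> \<theta>"
proof -
  have "transpose (c *\<^sub>R outer v v) = c *\<^sub>R outer v v" for c and v :: "real^'p"
    by (simp add: outer_def transpose_def vec_eq_iff mult.commute)
  then show ?thesis
    using integral_bounded_linear'[OF bounded_linear_transpose bounded_linear_transpose,
        of \<nu> "\<lambda>y. (f \<theta> y powr (1 + \<beta>)) *\<^sub>R outer (score f \<theta> y) (score f \<theta> y)"]
    by (simp add: J_mat_def transpose_transpose)
qed

lemma influence2_eq:
  assumes "has_two_derivatives (\<lambda>\<epsilon>. S (contamination F x \<epsilon>)) h' h'' 0 {0..1}"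
  shows "twice_differentiable_within (\<lambda>\<epsilon>. S (contamination F x \<epsilon>)) 0 {0..1}"
    and "influence2 x S F = h''"
  using has_two_derivatives_unique[OF assms] islimpt_Icc[of 0 "1::real"]
  by (auto simp: influence2_def trivial_limit_within)

lemma inner_matrix_vector_left:
  fixes A :: "real^'n^'m"
  shows "(A *v v) \<bullet> w = v \<bullet> (transpose A *v w)"
  by (metis dot_lmul_matrix vector_transpose_matrix)

theorem theorem1:
  fixes \<nu> :: "'x measure"
    and f :: "real^'p::finite \<Rightarrow> 'x \<Rightarrow> real"
    and \<Theta> :: "(real^'p) set"
    and \<theta>0 :: "real^'p"
    and \<beta> :: real
    and x :: 'x
    and m :: "real^'p \<Rightarrow> real^'r::finite"
  defines "F \<equiv> model_dist \<nu> f \<theta>0"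
    and "T \<equiv> mdpd \<nu> f \<Theta> \<beta>"
    and "J \<equiv> J_mat \<nu> f \<beta>"
    and "\<Sigma> \<equiv> Sigma_mat \<nu> f \<beta>"
    and "M \<equiv> M_mat m"
    and "v \<equiv> (f \<theta>0 x powr \<beta>) *\<^sub>R score f \<theta>0 x - xi_vec \<nu> f \<beta> \<theta>0"
  assumes density_measurable: "\<And>\<theta>. \<theta> \<in> \<Theta> \<Longrightarrow> f \<theta> \<in> borel_measurable \<nu>"
    and density_nonneg: "\<And>\<theta> y. \<theta> \<in> \<Theta> \<Longrightarrow> y \<in> space \<nu> \<Longrightarrow> 0 \<le> f \<theta> y"
    and density_prob: "\<And>\<theta>. \<theta> \<in> \<Theta> \<Longrightarrow> prob_space (model_dist \<nu> f \<theta>)"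
    and beta: "0 \<le> \<beta>"
    and theta0: "\<theta>0 \<in> \<Theta>"
    and x: "x \<in> space \<nu>"
    and J_invertible: "invertible (J \<theta>0)"
    and Sigma_invertible: "invertible (\<Sigma> \<theta>0)"
    and Fisher_consistent: "T F = \<theta>0"
    and T_twice_diff:
      "twice_differentiable_within (\<lambda>\<epsilon>. T (contamination F x \<epsilon>)) 0 {0..1}"
    and T_influence: "influence x T F = matrix_inv (J \<theta>0) *v v"
  shows
    "(twice_differentiable_within
        (\<lambda>\<epsilon>. wald_simple \<nu> f \<Theta> \<beta> \<theta>0 (contamination F x \<epsilon>)) 0 {0..1} \<and>
      influence2 x (wald_simple \<nu> f \<Theta> \<beta> \<theta>0) F =
        2 * (v \<bullet> ((matrix_inv (J \<theta>0) ** matrix_inv (\<Sigma> \<theta>0) ** matrix_inv (J \<theta>0)) *v v)))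
     \<and>
     (CARD('r) \<le> CARD('p) \<longrightarrow>
      (\<exists>U. open U \<and> \<theta>0 \<in> U \<and> (\<forall>\<theta>\<in>U. M_exists_at m \<theta>) \<and> continuous_on U M) \<longrightarrow>
      rank (M \<theta>0) = CARD('r) \<longrightarrow>
      \<theta>0 \<in> {\<theta> \<in> \<Theta>. m \<theta> = 0} \<longrightarrow>
      invertible (Sigma_star \<nu> f \<beta> m \<theta>0) \<longrightarrow>
      twice_differentiable_within (\<lambda>\<epsilon>. M (T (contamination F x \<epsilon>))) 0 {0..1} \<longrightarrow>
      twice_differentiable_within (\<lambda>\<epsilon>. \<Sigma> (T (contamination F x \<epsilon>))) 0 {0..1} \<longrightarrow>
      twice_differentiable_within
        (\<lambda>\<epsilon>. wald_composite \<nu> f \<Theta> \<beta> m (contamination F x \<epsilon>)) 0 {0..1} \<and>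
      influence2 x (wald_composite \<nu> f \<Theta> \<beta> m) F =
        2 * (v \<bullet> ((matrix_inv (J \<theta>0) ** M \<theta>0 ** matrix_inv (Sigma_star \<nu> f \<beta> m \<theta>0)
                    ** transpose (M \<theta>0) ** matrix_inv (J \<theta>0)) *v v)))"
proof -
  let ?A = "{0..1::real}" and ?\<tau> = "\<lambda>\<epsilon>. T (contamination F x \<epsilon>)"
  let ?\<tau>' = "\<lambda>s. vector_derivative ?\<tau> (at s within ?A)"
  let ?R = "matrix_inv (J \<theta>0)"
  have 0: "(0::real) \<in> ?A" by simp
  obtain \<tau>'' where \<tau>: "has_two_derivatives ?\<tau> ?\<tau>' \<tau>'' 0 ?A"
    using twice_differentiable_withinD[OF T_twice_diff 0] by blast
  have \<tau>0: "?\<tau> 0 = \<theta>0" using Fisher_consistent by simp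
  have \<tau>'0: "?\<tau>' 0 = ?R *v v" using T_influence by (simp add: influence_def)
  have R: "transpose ?R = ?R"
    using matrix_inv_transpose[OF J_invertible] by (simp add: J_def transpose_J_mat)

  obtain h' where simple: "has_two_derivatives
      (\<lambda>\<epsilon>. wald_simple \<nu> f \<Theta> \<beta> \<theta>0 (contamination F x \<epsilon>)) h'
      (2 * ((?R *v v) \<bullet> (matrix_inv (\<Sigma> \<theta>0) *v (?R *v v)))) 0 ?A"
    using has_two_derivatives_quadratic_form[OF has_two_derivatives_diff_const[OF \<tau>]
        has_two_derivatives_const 0, of \<theta>0 "matrix_inv (\<Sigma> \<theta>0)"] \<tau>0
    unfolding wald_simple_def T_def[symmetric] \<Sigma>_def[symmetric] \<tau>'0 by auto
  have simple_value: "(?R *v v) \<bullet> (matrix_inv (\<Sigma> \<theta>0) *v (?R *v v))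
      = v \<bullet> ((?R ** matrix_inv (\<Sigma> \<theta>0) ** ?R) *v v)"
    by (simp only: inner_matrix_vector_left R matrix_vector_mul_assoc matrix_mul_assoc)

  have composite: "twice_differentiable_within
        (\<lambda>\<epsilon>. wald_composite \<nu> f \<Theta> \<beta> m (contamination F x \<epsilon>)) 0 ?A \<and>
      influence2 x (wald_composite \<nu> f \<Theta> \<beta> m) F =
        2 * (v \<bullet> ((?R ** M \<theta>0 ** matrix_inv (Sigma_star \<nu> f \<beta> m \<theta>0)
                    ** transpose (M \<theta>0) ** ?R) *v v))"
    if U: "open U" "\<theta>0 \<in> U" "\<forall>\<theta>\<in>U. M_exists_at m \<theta>" "continuous_on U M"
      and m0: "m \<theta>0 = 0" and inv: "invertible (Sigma_star \<nu> f \<beta> m \<theta>0)"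
      and M2: "twice_differentiable_within (\<lambda>\<epsilon>. M (?\<tau> \<epsilon>)) 0 ?A"
      and \<Sigma>2: "twice_differentiable_within (\<lambda>\<epsilon>. \<Sigma> (?\<tau> \<epsilon>)) 0 ?A" for U
  proof -
    let ?S = "\<lambda>s. transpose (M (?\<tau> s)) ** \<Sigma> (?\<tau> s) ** M (?\<tau> s)"
    let ?B = "matrix_inv (Sigma_star \<nu> f \<beta> m \<theta>0)"
    have S_eq: "Sigma_star \<nu> f \<beta> m \<theta> = transpose (M \<theta>) ** \<Sigma> \<theta> ** M \<theta>" for \<theta>
      by (simp add: Sigma_star_def M_def \<Sigma>_def)
    obtain M' M'' where M: "has_two_derivatives (\<lambda>\<epsilon>. M (?\<tau> \<epsilon>)) M' M'' 0 ?A"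
      using twice_differentiable_withinD[OF M2 0] by blast
    obtain \<Sigma>' \<Sigma>'' where \<Sigma>: "has_two_derivatives (\<lambda>\<epsilon>. \<Sigma> (?\<tau> \<epsilon>)) \<Sigma>' \<Sigma>'' 0 ?A"
      using twice_differentiable_withinD[OF \<Sigma>2 0] by blast
    note Mt = bounded_linear.has_two_derivatives[OF bounded_linear_transpose M]
    note mm = has_two_derivatives_bilinear[OF bounded_bilinear_matrix_matrix_mult]
    have "invertible (?S 0)" using inv by (simp add: S_eq Fisher_consistent)
    from has_two_derivatives_matrix_inv[OF mm[OF mm[OF Mt \<Sigma> 0] M 0] 0 this]
    obtain B' B'' where B: "has_two_derivatives (\<lambda>s. matrix_inv (?S s)) B' B'' 0 ?A"
      by blast
    have dm: "(m has_derivative (\<lambda>h. transpose (M \<theta>) *v h)) (at \<theta>)" if "\<theta> \<in> U" for \<theta>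
      using has_derivative_M_mat[of U \<theta> m] U that by (simp add: M_def)
    have g: "has_two_derivatives (\<lambda>s. m (?\<tau> s)) (\<lambda>s. transpose (M (?\<tau> s)) *v ?\<tau>' s)
        (transpose (M (?\<tau> 0)) *v \<tau>'' + transpose (M' 0) *v ?\<tau>' 0) 0 ?A"
      by (rule has_two_derivatives_compose[where M = "\<lambda>\<theta>. transpose (M \<theta>)",
            OF \<tau> 0 U(1) _ dm has_two_derivativesD[OF Mt 0]])
        (use U(2) \<tau>0 in auto)
    let ?d = "transpose (M \<theta>0) *v (?R *v v)"
    have "m (?\<tau> 0) = 0" using \<tau>0 m0 by simp
    from has_two_derivatives_quadratic_form[OF g B 0 this]
    obtain h' where h: "has_two_derivatives
        (\<lambda>\<epsilon>. wald_composite \<nu> f \<Theta> \<beta> m (contamination F x \<epsilon>)) h' (2 * (?d \<bullet> (?B *v ?d))) 0 ?A"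
      unfolding wald_composite_def T_def[symmetric] S_eq \<tau>'0 \<tau>0 by blast
    have "?d \<bullet> (?B *v ?d) = v \<bullet> ((?R ** M \<theta>0 ** ?B ** transpose (M \<theta>0) ** ?R) *v v)"
      by (simp only: inner_matrix_vector_left R matrix_transpose_mul transpose_transpose
          matrix_vector_mul_assoc matrix_mul_assoc)
    then show ?thesis
      using influence2_eq[OF h] by simp
  qed
  show ?thesis
    using influence2_eq[OF simple] composite by (auto simp: simple_value)
qed

end
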